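(* $\mathrm{Aut}(\mathrm{Sol}_1^4)=\mathbb{R}\rtimes\mathrm{Aut}(\mathrm{Sol}^3)=(\mathbb{R}\times\mathrm{Sol}^3)\rtimes (\mathbb{R}^+ \times D_4)$.
   Context: $\mathrm{Sol}_1^4$ is the group of real matrices $\left[\begin{smallmatrix} 1 &x &z\\ 0 &e^u &y\\ 0 &0 &1 \end{smallmatrix}\right]$, with center $\mathbb{R}$ and quotient $\mathrm{Sol}^3=\mathbb{R}^2\rtimes\mathbb{R}$ (operation $(\mathbf{x},u)(\mathbf{y},v)=(\mathbf{x}+\mathrm{diag}(e^{-u},e^{u})\mathbf{y},u+v)$). It is known that $\mathrm{Aut}(\mathrm{Sol}^3)=\mathrm{Sol}^3\rtimes(\mathbb{R}^+\times D_4)$, where $\mathbb{R}^+$ are positive scalar matrices and $D_4=\{\left[\begin{smallmatrix}\pm1&0\\0&\pm1\end{smallmatrix}\right],\left[\begin{smallmatrix}0&\pm1\\\pm1&0\end{smallmatrix}\right]\}$, and every automorphism of $\mathrm{Sol}^3$ lifts to $\mathrm{Sol}_1^4$. The kernel of $\mathrm{Aut}(\mathrm{Sol}_1^4)\to\mathrm{Aut}(\mathrm{Sol}^3)$ is $Z^1(\mathrm{Sol}^3,\mathbb{R})=\mathrm{Hom}(\mathrm{Sol}^3,\mathbb{R})\cong\mathbb{R}$, consisting of the automorphisms $\hat k$, $k\in\mathbb{R}$, sending $\left[\begin{smallmatrix} 1 &e^u x &z\\ 0 &e^u &y\\ 0 &0 &1 \end{smallmatrix}\right]$ to $\left[\begin{smallmatrix}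 1 &e^u x &z+ku\\ 0 &e^u &y\\ 0 &0 &1 \end{smallmatrix}\right]$. These commute with inner automorphisms, and $A\in D_4$ acts on this $\mathbb{R}$ by $^A\hat k=(\hat A\cdot\bar A)\hat k$, where $\hat A=\det(A)$ is the induced action on the center and $\bar A=\pm1$ the induced action on $\mathrm{Sol}^3/\mathbb{R}^2\cong\mathbb{R}$ ($\bar A=+1$ for diagonal $A$, $-1$ otherwise). *)

theory Defs
  imports "HOL-Analysis.Analysis" "HOL-Algebra.Coset"
begin

text \<open>Sol_1^4: the element (x,y,z,u) stands for the matrix
  [[1, e^u x, z],[0, e^u, y],[0,0,1]]; the operation below is matrix multiplication
  written in these coordinates.\<close>
definition sol4_mult :: "real \<times> real \<times> real \<times> real \<Rightarrow> real \<times> real \<times> real \<times> real \<Rightarrow> real \<times> real \<times> real \<times> real" where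
  "sol4_mult p q = (case p of (x, y, z, u) \<Rightarrow> case q of (x', y', z', u') \<Rightarrow>
      (x + exp (- u) * x', y + exp u * y', z + z' + exp u * x * y', u + u'))"

text \<open>Sol^3 = R^2 \<rtimes> R with ((x1,x2),u)((y1,y2),v) = ((x1 + e^{-u} y1, x2 + e^u y2), u+v).\<close>
definition sol3_mult :: "(real \<times> real) \<times> real \<Rightarrow> (real \<times> real) \<times> real \<Rightarrow> (real \<times> real) \<times> real" where
  "sol3_mult p q = (case p of ((x1, x2), u) \<Rightarrow> case q of ((y1, y2), v) \<Rightarrow>
      ((x1 + exp (- u) * y1, x2 + exp u * y2), u + v))"

definition Sol3 :: "((real \<times> real) \<times> real) monoid" where
  "Sol3 = \<lparr>carrier = UNIV, mult = sol3_mult, one = ((0, 0), 0)\<rparr>"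

text \<open>Quotient map Sol_1^4 \<rightarrow> Sol^3 = Sol_1^4 / centre (forget z).\<close>
definition sol4_proj :: "real \<times> real \<times> real \<times> real \<Rightarrow> (real \<times> real) \<times> real" where
  "sol4_proj p = (case p of (x, y, z, u) \<Rightarrow> ((x, y), u))"

text \<open>Automorphisms of a Lie group whose underlying space is the whole type:
  bijective homomorphisms that are homeomorphisms.\<close>
definition lie_auts :: "('a::topological_space \<Rightarrow> 'a \<Rightarrow> 'a) \<Rightarrow> ('a \<Rightarrow> 'a) set" where
  "lie_auts m = {f. (\<forall>x y. f (m x y) = m (f x) (f y)) \<and> continuous_on UNIV f
                    \<and> (\<exists>g. (\<forall>x. g (f x) = x) \<and> (\<forall>y. f (g y) = y) \<and> continuous_on UNIV g)}"

definition Aut_group :: "('a::topological_space \<Rightarrow> 'a \<Rightarrow> 'a) \<Rightarrow> ('a \<Rightarrow> 'a) monoid" where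
  "Aut_group m = \<lparr>carrier = lie_auts m, mult = (\<circ>), one = id\<rparr>"

abbreviation "Aut_Sol4 \<equiv> Aut_group sol4_mult"
abbreviation "Aut_Sol3 \<equiv> Aut_group sol3_mult"

text \<open>Kernel of Aut(Sol_1^4) \<rightarrow> Aut(Sol^3): automorphisms inducing the identity on Sol^3.\<close>
definition aut_kernel :: "(real \<times> real \<times> real \<times> real \<Rightarrow> real \<times> real \<times> real \<times> real) set" where
  "aut_kernel = {f \<in> lie_auts sol4_mult. \<forall>p. sol4_proj (f p) = sol4_proj p}"

definition R_add :: "real monoid" where
  "R_add = \<lparr>carrier = UNIV, mult = (+), one = 0\<rparr>"

definition R_pos :: "real monoid" where
  "R_pos = \<lparr>carrier = {r. r > 0}, mult = (*), one = 1\<rparr>"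

text \<open>D_4: signed permutation 2x2 matrices under matrix multiplication.\<close>
definition D4 :: "(real^2^2) monoid" where
  "D4 = \<lparr>carrier = {A. \<exists>s t. s \<in> {-1, 1} \<and> t \<in> {-1, 1} \<and>
              (A = vector [vector [s, 0], vector [0, t]] \<or> A = vector [vector [0, s], vector [t, 0]])},
         mult = (**), one = mat 1\<rparr>"

text \<open>Internal semidirect product decomposition G = N \<rtimes> H.\<close>
definition int_semidirect :: "('a, 'b) monoid_scheme \<Rightarrow> 'a set \<Rightarrow> 'a set \<Rightarrow> bool" where
  "int_semidirect G N H \<longleftrightarrow> N \<lhd> G \<and> subgroup H G \<and> N \<inter> H = {\<one>\<^bsub>G\<^esub>}
      \<and> N <#>\<^bsub>G\<^esub> H = carrier G"

end

theory Submission
  imports Defs "HOL-Algebra.SndIsomorphismGrp"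
begin

text \<open>An automorphism of \<open>Sol\<^sub>1\<^sup>4\<close> preserves the centre \<open>{(0, 0, z, 0)}\<close> and so induces an
  automorphism of \<open>Sol\<^sup>3\<close>; this gives a homomorphism \<open>\<pi> : Aut(Sol\<^sub>1\<^sup>4) \<rightarrow> Aut(Sol\<^sup>3)\<close>.
  Its kernel consists of the automorphisms \<open>z \<mapsto> z + \<phi>(p)\<close> for a continuous character \<open>\<phi>\<close>, and
  every continuous character of \<open>Sol\<^sub>1\<^sup>4\<close> is a multiple of the \<open>u\<close>-coordinate, so the kernel is
  \<open>{\<hat>k | k \<in> \<real>} \<cong> \<real>\<close>.  Classifying the automorphisms of \<open>Sol\<^sup>3\<close> (they are inner automorphisms
  composed with a diagonal map, possibly after the flip \<open>(x, y, u) \<mapsto> (y, x, -u)\<close>) shows that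
  \<open>L = Inn(Sol\<^sub>1\<^sup>4) \<cdot> (\<real>\<^sup>+ \<times> D\<^sub>4)\<close> is mapped by \<open>\<pi>\<close> onto \<open>Aut(Sol\<^sup>3)\<close> and meets the kernel trivially,
  giving the first splitting.  Regrouping \<open>ker \<pi> \<cdot> Inn \<cdot> (\<real>\<^sup>+ \<times> D\<^sub>4)\<close> gives the second one,
  where \<open>ker \<pi> \<cdot> Inn \<cong> \<real> \<times> Sol\<^sup>3\<close> because \<open>\<hat>k\<close> commutes with inner automorphisms and
  \<open>Inn(Sol\<^sub>1\<^sup>4) \<cong> Sol\<^sup>3\<close>.\<close>

section \<open>Internal semidirect products\<close>

lemma (in group) normal_set_mult_normal:
  assumes N: "N \<lhd> G" and M: "M \<lhd> G"
  shows "N <#> M \<lhd> G"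
proof -
  have sub: "subgroup (N <#> M) G"
    using second_isomorphism_grp.normal_set_mult_subgroup[of N G M] N M
    by (simp add: second_isomorphism_grp_def second_isomorphism_grp_axioms_def normal_imp_subgroup)
  have "x \<otimes> (n \<otimes> m) \<otimes> inv x \<in> N <#> M"
    if "x \<in> carrier G" "n \<in> N" "m \<in> M" for x n m
  proof -
    have nm: "n \<in> carrier G" "m \<in> carrier G"
      using that N M by (auto dest: normal_imp_subgroup subgroup.mem_carrier)
    have cancel: "inv x \<otimes> (x \<otimes> y) = y" if "y \<in> carrier G" for y
      using \<open>x \<in> carrier G\<close> that by (simp flip: m_assoc)
    have "x \<otimes> (n \<otimes> m) \<otimes> inv x = (x \<otimes> n \<otimes> inv x) \<otimes> (x \<otimes> m \<otimes> inv x)"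
      using that nm by (simp add: m_assoc cancel)
    moreover have "x \<otimes> n \<otimes> inv x \<in> N" "x \<otimes> m \<otimes> inv x \<in> M"
      using that N M by (simp_all add: normal.inv_op_closed2)
    ultimately show ?thesis unfolding set_mult_def by blast
  qed
  then show ?thesis
    using sub by (auto simp: normal_inv_iff set_mult_def)
qed

lemma iso_image_of_inj_hom:
  assumes "group G" "h \<in> hom G H" "inj_on h (carrier G)"
  shows "H\<lparr>carrier := h ` carrier G\<rparr> \<cong> G"
proof -
  have "h \<in> iso G (H\<lparr>carrier := h ` carrier G\<rparr>)"
    using assms(2,3) by (auto simp: iso_def hom_def bij_betw_def)
  then show ?thesis
    using group.iso_sym[OF assms(1)] is_isoI by blast
qed

lemma int_semidirect_kernel_complement:
  assumes \<pi>: "group_hom G H \<pi>" and L: "subgroup L G"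
    and onto: "\<pi> ` L = carrier H" and disjoint: "kernel G H \<pi> \<inter> L = {\<one>\<^bsub>G\<^esub>}"
  shows "int_semidirect G (kernel G H \<pi>) L \<and> G\<lparr>carrier := L\<rparr> \<cong> H"
proof -
  interpret \<pi>: group_hom G H \<pi> by (rule \<pi>)
  have L_sub: "L \<subseteq> carrier G" by (rule subgroup.subset[OF L])
  have K_sub: "kernel G H \<pi> \<subseteq> carrier G" by (simp add: kernel_def)
  have "carrier G \<subseteq> kernel G H \<pi> <#>\<^bsub>G\<^esub> L"
  proof
    fix g assume g: "g \<in> carrier G"
    have "\<pi> g \<in> \<pi> ` L" using onto \<pi>.hom_closed[OF g] by simp
    then obtain l where l: "l \<in> L" "\<pi> l = \<pi> g" by (metis imageE)
    have lG: "l \<in> carrier G" using l(1) L_sub by blast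
    have "g \<otimes>\<^bsub>G\<^esub> inv\<^bsub>G\<^esub> l \<in> kernel G H \<pi>"
      using g lG l(2) by (simp add: kernel_def \<pi>.hom_mult \<pi>.hom_inv)
    moreover have "g = (g \<otimes>\<^bsub>G\<^esub> inv\<^bsub>G\<^esub> l) \<otimes>\<^bsub>G\<^esub> l"
      using g lG by (simp add: \<pi>.G.m_assoc)
    ultimately show "g \<in> kernel G H \<pi> <#>\<^bsub>G\<^esub> L"
      using l(1) unfolding set_mult_def by blast
  qed
  then have prod: "kernel G H \<pi> <#>\<^bsub>G\<^esub> L = carrier G"
    using \<pi>.G.setmult_subset_G[OF K_sub L_sub] by blast
  have "kernel (G\<lparr>carrier := L\<rparr>) H \<pi> = kernel G H \<pi> \<inter> L"
    using L_sub by (auto simp: kernel_def)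
  then have "inj_on \<pi> L"
    using \<pi>.inj_on_subgroup_iff_trivial_ker[OF L] disjoint by simp
  moreover have "\<pi> \<in> hom (G\<lparr>carrier := L\<rparr>) H"
    using L_sub by (auto simp: hom_def subset_iff)
  ultimately have "\<pi> \<in> iso (G\<lparr>carrier := L\<rparr>) H"
    using onto by (simp add: iso_def bij_betw_def)
  then show ?thesis
    unfolding int_semidirect_def using \<pi>.normal_kernel L disjoint prod is_isoI by blast
qed

section \<open>Automorphism groups of topological groups\<close>

lemma lie_autsI:
  assumes "\<And>x y. f (m x y) = m (f x) (f y)" "continuous_on UNIV f"
    and "\<And>x. g (f x) = x" "\<And>y. f (g y) = y" "continuous_on UNIV g"
  shows "f \<in> lie_auts m"
  using assms unfolding lie_auts_def by blast

lemma lie_auts_hom: "f \<in> lie_auts m \<Longrightarrow> f (m x y) = m (f x) (f y)"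
  by (simp add: lie_auts_def)

lemma lie_auts_continuous: "f \<in> lie_auts m \<Longrightarrow> continuous_on UNIV f"
  by (simp add: lie_auts_def)

lemma lie_auts_inverse:
  assumes f: "f \<in> lie_auts m"
  obtains g where "g \<in> lie_auts m" "g \<circ> f = id" "f \<circ> g = id"
proof -
  obtain g where g: "\<And>x. g (f x) = x" "\<And>y. f (g y) = y" "continuous_on UNIV g"
    using f by (auto simp: lie_auts_def)
  have "g (m x y) = m (g x) (g y)" for x y
    by (metis g(1,2) lie_auts_hom[OF f])
  then have "g \<in> lie_auts m"
    using g lie_auts_continuous[OF f] by (intro lie_autsI[where g = f])
  with g show ?thesis
    by (intro that) (auto simp: fun_eq_iff)
qed

lemma lie_auts_comp:
  assumes f: "f \<in> lie_auts m" and g: "g \<in> lie_auts m"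
  shows "f \<circ> g \<in> lie_auts m"
proof -
  obtain f' where f': "f' \<in> lie_auts m" "f' \<circ> f = id" "f \<circ> f' = id"
    using f by (rule lie_auts_inverse)
  obtain g' where g': "g' \<in> lie_auts m" "g' \<circ> g = id" "g \<circ> g' = id"
    using g by (rule lie_auts_inverse)
  show ?thesis
  proof (rule lie_autsI[where g = "g' \<circ> f'"])
    show "continuous_on UNIV (f \<circ> g)" "continuous_on UNIV (g' \<circ> f')"
      using f g f' g' by (auto intro: continuous_on_compose2 lie_auts_continuous)
  qed (use f g f' g' in \<open>simp_all add: lie_auts_hom pointfree_idE\<close>)
qed

lemma lie_auts_eq_iff:
  assumes "f \<in> lie_auts m"
  shows "f x = f y \<longleftrightarrow> x = y"
proof -
  obtain g where "g \<circ> f = id"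
    using assms by (rule lie_auts_inverse)
  then show ?thesis
    by (metis pointfree_idE)
qed

lemma id_lie_auts: "id \<in> lie_auts m"
  by (rule lie_autsI[where g = id]) simp_all

lemma Aut_group_simps [simp]:
  "carrier (Aut_group m) = lie_auts m" "x \<otimes>\<^bsub>Aut_group m\<^esub> y = x \<circ> y" "\<one>\<^bsub>Aut_group m\<^esub> = id"
  by (simp_all add: Aut_group_def)

lemma group_Aut_group: "group (Aut_group m)"
proof (rule groupI)
  fix f assume "f \<in> carrier (Aut_group m)"
  then obtain g where "g \<in> lie_auts m" "g \<circ> f = id"
    by (auto elim: lie_auts_inverse)
  then show "\<exists>g\<in>carrier (Aut_group m). g \<otimes>\<^bsub>Aut_group m\<^esub> f = \<one>\<^bsub>Aut_group m\<^esub>"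
    by auto
qed (simp_all add: lie_auts_comp id_lie_auts comp_assoc)

lemma set_mult_Aut_group_iff: "f \<in> A <#>\<^bsub>Aut_group m\<^esub> B \<longleftrightarrow> (\<exists>a\<in>A. \<exists>b\<in>B. f = a \<circ> b)"
  by (auto simp: set_mult_def)

lemma lie_auts_group_hom:
  assumes "group G" "carrier G = UNIV" "f \<in> lie_auts (mult G)"
  shows "group_hom G G f"
  using assms by (simp add: group_hom_def group_hom_axioms_def hom_def lie_auts_hom)

lemma lie_auts_preserve_central:
  assumes f: "f \<in> lie_auts m" and c: "\<And>q. m c q = m q c"
  shows "m (f c) q = m q (f c)"
proof -
  obtain g where "g \<in> lie_auts m" "f \<circ> g = id"
    using f by (rule lie_auts_inverse)
  then have q: "f (g q) = q" by (simp add: pointfree_idE)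
  have "m (f c) q = f (m c (g q))" by (simp add: lie_auts_hom[OF f] q)
  also have "\<dots> = f (m (g q) c)" by (simp add: c)
  also have "\<dots> = m q (f c)" by (simp add: lie_auts_hom[OF f] q)
  finally show ?thesis .
qed

definition inner_aut :: "('a, 'b) monoid_scheme \<Rightarrow> 'a \<Rightarrow> 'a \<Rightarrow> 'a" where
  "inner_aut G g x = g \<otimes>\<^bsub>G\<^esub> x \<otimes>\<^bsub>G\<^esub> inv\<^bsub>G\<^esub> g"

context group
begin

lemma inner_aut_mult:
  assumes "g \<in> carrier G" "h \<in> carrier G" "x \<in> carrier G"
  shows "inner_aut G (g \<otimes> h) x = inner_aut G g (inner_aut G h x)"
  using assms by (simp add: inner_aut_def inv_mult_group m_assoc)

lemma inner_aut_one: "x \<in> carrier G \<Longrightarrow> inner_aut G \<one> x = x"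
  by (simp add: inner_aut_def)

lemma inner_aut_hom:
  assumes "g \<in> carrier G" "x \<in> carrier G" "y \<in> carrier G"
  shows "inner_aut G g (x \<otimes> y) = inner_aut G g x \<otimes> inner_aut G g y"
proof -
  have "inv g \<otimes> (g \<otimes> z) = z" if "z \<in> carrier G" for z
    using assms(1) that by (simp flip: m_assoc)
  with assms show ?thesis by (simp add: inner_aut_def m_assoc)
qed

end

lemma lie_auts_comp_inner_aut:
  assumes G: "group G" "carrier G = UNIV" and f: "f \<in> lie_auts (mult G)"
  shows "f \<circ> inner_aut G g = inner_aut G (f g) \<circ> f"
proof -
  interpret group_hom G G f by (rule lie_auts_group_hom[OF G f])
  show ?thesis by (simp add: fun_eq_iff inner_aut_def G(2))
qed

section \<open>The groups \<open>Sol\<^sup>3\<close> and \<open>Sol\<^sub>1\<^sup>4\<close>\<close>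

lemma sol4_mult_eq [simp]:
  "sol4_mult (x, y, z, u) (x', y', z', u') = (x + exp (- u) * x', y + exp u * y', z + z' + exp u * x * y', u + u')"
  by (simp add: sol4_mult_def)

lemma sol3_mult_eq [simp]:
  "sol3_mult ((x, y), u) ((x', y'), u') = ((x + exp (- u) * x', y + exp u * y'), u + u')"
  by (simp add: sol3_mult_def)

definition Sol4 :: "(real \<times> real \<times> real \<times> real) monoid" where
  "Sol4 = \<lparr>carrier = UNIV, mult = sol4_mult, one = (0, 0, 0, 0)\<rparr>"

lemma Sol4_simps [simp]: "carrier Sol4 = UNIV" "\<one>\<^bsub>Sol4\<^esub> = (0, 0, 0, 0)"
  by (simp_all add: Sol4_def)

lemma Sol4_mult: "x \<otimes>\<^bsub>Sol4\<^esub> y = sol4_mult x y"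
  by (simp add: Sol4_def)

lemma Sol3_simps [simp]: "carrier Sol3 = UNIV" "\<one>\<^bsub>Sol3\<^esub> = ((0, 0), 0)"
  by (simp_all add: Sol3_def)

lemma Sol3_mult: "x \<otimes>\<^bsub>Sol3\<^esub> y = sol3_mult x y"
  by (simp add: Sol3_def)

lemma group_Sol4: "group Sol4"
proof (rule groupI)
  fix p :: "real \<times> real \<times> real \<times> real"
  obtain x y z u where p: "p = (x, y, z, u)" by (cases p)
  show "\<exists>q\<in>carrier Sol4. q \<otimes>\<^bsub>Sol4\<^esub> p = \<one>\<^bsub>Sol4\<^esub>"
    by (rule bexI[of _ "(- (exp u * x), - (exp (- u) * y), x * y - z, - u)"])
      (simp_all add: Sol4_mult p exp_minus field_simps)
qed (auto simp: Sol4_mult algebra_simps simp flip: exp_add)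

lemma group_Sol3: "group Sol3"
proof (rule groupI)
  fix q :: "(real \<times> real) \<times> real"
  obtain x y u where q: "q = ((x, y), u)" by (metis prod.exhaust)
  show "\<exists>q'\<in>carrier Sol3. q' \<otimes>\<^bsub>Sol3\<^esub> q = \<one>\<^bsub>Sol3\<^esub>"
    by (rule bexI[of _ "((- (exp u * x), - (exp (- u) * y)), - u)"])
      (simp_all add: Sol3_mult q exp_minus field_simps)
qed (auto simp: Sol3_mult algebra_simps simp flip: exp_add)

lemma inv_Sol4: "inv\<^bsub>Sol4\<^esub> (x, y, z, u) = (- (exp u * x), - (exp (- u) * y), x * y - z, - u)"
  by (rule group.inv_equality[OF group_Sol4]) (simp_all add: Sol4_mult exp_minus field_simps)

lemma inner_aut_Sol4:
  "inner_aut Sol4 (p, q, r, v) (x, y, z, u) =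
     (exp (- v) * x + p * (1 - exp (- u)), exp v * y + q * (1 - exp u),
      z + exp v * p * y - exp (u - v) * x * q + p * q * (1 - exp u), u)"
  by (simp add: inner_aut_def Sol4_mult inv_Sol4 exp_add exp_diff exp_minus field_simps)

lemma continuous_inner_aut_Sol4: "continuous_on UNIV (inner_aut Sol4 g)"
proof -
  obtain p q r v where g: "g = (p, q, r, v)" by (cases g)
  have eq: "inner_aut Sol4 g = (\<lambda>(x, y, z, u). (exp (- v) * x + p * (1 - exp (- u)), exp v * y + q * (1 - exp u),
      z + exp v * p * y - exp (u - v) * x * q + p * q * (1 - exp u), u))"
    by (auto simp: fun_eq_iff g inner_aut_Sol4)
  show ?thesis
    unfolding eq case_prod_unfold by (intro continuous_intros)
qed

lemma inner_aut_Sol4_lie_auts: "inner_aut Sol4 g \<in> lie_auts sol4_mult"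
proof (rule lie_autsI[where g = "inner_aut Sol4 (inv\<^bsub>Sol4\<^esub> g)"])
  interpret Sol4: group Sol4 by (rule group_Sol4)
  show "inner_aut Sol4 g (sol4_mult x y) = sol4_mult (inner_aut Sol4 g x) (inner_aut Sol4 g y)" for x y
    using Sol4.inner_aut_hom[of g x y] by (simp add: Sol4_mult)
  show "inner_aut Sol4 (inv\<^bsub>Sol4\<^esub> g) (inner_aut Sol4 g x) = x" "inner_aut Sol4 g (inner_aut Sol4 (inv\<^bsub>Sol4\<^esub> g) x) = x" for x
    by (simp_all flip: Sol4.inner_aut_mult add: Sol4.inner_aut_one[simplified])
qed (rule continuous_inner_aut_Sol4)+

lemma inner_aut_Sol4_mult: "inner_aut Sol4 (sol4_mult g h) = inner_aut Sol4 g \<circ> inner_aut Sol4 h"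
  using group.inner_aut_mult[OF group_Sol4, of g h] by (simp add: fun_eq_iff Sol4_mult)

lemma inner_aut_Sol4_one: "inner_aut Sol4 (0, 0, 0, 0) = id"
  by (simp add: fun_eq_iff inner_aut_Sol4)

lemma inner_aut_Sol4_hom: "inner_aut Sol4 \<in> hom Sol4 Aut_Sol4"
  by (rule homI) (simp_all add: inner_aut_Sol4_lie_auts inner_aut_Sol4_mult Sol4_mult)

lemma sol4_aut_comp_inner_aut: "f \<in> lie_auts sol4_mult \<Longrightarrow> f \<circ> inner_aut Sol4 g = inner_aut Sol4 (f g) \<circ> f"
  using lie_auts_comp_inner_aut[OF group_Sol4, of f g] by (simp add: Sol4_def)

lemma inner_aut_Sol4_centre_invariant: "inner_aut Sol4 (p, q, r, v) = inner_aut Sol4 (p, q, r', v)"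
  by (simp add: fun_eq_iff inner_aut_Sol4)

text \<open>The automorphism \<open>\<hat>k\<close> of the paper.\<close>
definition khat :: "real \<Rightarrow> real \<times> real \<times> real \<times> real \<Rightarrow> real \<times> real \<times> real \<times> real" where
  "khat k = (\<lambda>(x, y, z, u). (x, y, z + k * u, u))"

definition diag_aut :: "real \<Rightarrow> real \<Rightarrow> real \<times> real \<times> real \<times> real \<Rightarrow> real \<times> real \<times> real \<times> real" where
  "diag_aut a d = (\<lambda>(x, y, z, u). (a * x, d * y, a * d * z, u))"

definition flip_aut :: "real \<times> real \<times> real \<times> real \<Rightarrow> real \<times> real \<times> real \<times> real" where
  "flip_aut = (\<lambda>(x, y, z, u). (y, x, x * y - z, - u))"

lemma khat_apply [simp]: "khat k (x, y, z, u) = (x, y, z + k * u, u)"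
  by (simp add: khat_def)

lemma diag_aut_apply [simp]: "diag_aut a d (x, y, z, u) = (a * x, d * y, a * d * z, u)"
  by (simp add: diag_aut_def)

lemma flip_aut_apply [simp]: "flip_aut (x, y, z, u) = (y, x, x * y - z, - u)"
  by (simp add: flip_aut_def)

lemma khat_comp_khat: "khat k \<circ> khat k' = khat (k + k')"
  by (auto simp: fun_eq_iff algebra_simps)

lemma khat_0: "khat 0 = id"
  by (auto simp: fun_eq_iff)

lemma diag_aut_comp_diag_aut: "diag_aut a d \<circ> diag_aut a' d' = diag_aut (a * a') (d * d')"
  by (auto simp: fun_eq_iff)

lemma diag_aut_1: "diag_aut 1 1 = id"
  by (auto simp: fun_eq_iff)

lemma flip_aut_comp_flip_aut: "flip_aut \<circ> flip_aut = id"
  by (auto simp: fun_eq_iff)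

lemma flip_aut_comp_diag_aut: "flip_aut \<circ> diag_aut a d = diag_aut d a \<circ> flip_aut"
  by (auto simp: fun_eq_iff algebra_simps)

lemma khat_lie_auts: "khat k \<in> lie_auts sol4_mult"
proof (rule lie_autsI[where g = "khat (- k)"])
  show "continuous_on UNIV (khat k)" "continuous_on UNIV (khat (- k))"
    unfolding khat_def case_prod_unfold by (intro continuous_intros)+
qed (auto simp: algebra_simps)

lemma diag_aut_lie_auts: "a \<noteq> 0 \<Longrightarrow> d \<noteq> 0 \<Longrightarrow> diag_aut a d \<in> lie_auts sol4_mult"
proof (rule lie_autsI[where g = "diag_aut (1 / a) (1 / d)"])
  show "continuous_on UNIV (diag_aut a d)" "continuous_on UNIV (diag_aut (1 / a) (1 / d))"
    unfolding diag_aut_def case_prod_unfold by (intro continuous_intros)+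
qed (auto simp: algebra_simps)

lemma flip_aut_lie_auts: "flip_aut \<in> lie_auts sol4_mult"
proof -
  have "continuous_on UNIV flip_aut"
    unfolding flip_aut_def case_prod_unfold by (intro continuous_intros)
  then show ?thesis
    by (intro lie_autsI[where g = flip_aut]) (auto simp: algebra_simps exp_minus field_simps)
qed

lemma khat_comp_inner_aut: "khat k \<circ> inner_aut Sol4 g = inner_aut Sol4 g \<circ> khat k"
proof -
  obtain p q r v where g: "g = (p, q, r, v)" by (cases g)
  show ?thesis
    using sol4_aut_comp_inner_aut[OF khat_lie_auts, of k g]
    by (simp add: g inner_aut_Sol4_centre_invariant[of p q "r + k * v" v r])
qed

section \<open>Continuous characters\<close>

lemma additive_continuous_imp_scaleR:
  fixes f :: "real \<Rightarrow> 'a::real_normed_vector"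
  assumes add: "\<And>x y. f (x + y) = f x + f y" and cont: "continuous_on UNIV f"
  shows "f x = x *\<^sub>R f 1"
proof -
  define g where "g x = f x - x *\<^sub>R f 1" for x
  interpret g: additive g
    by unfold_locales (simp add: g_def add scaleR_add_left)
  have g_of_nat: "g (of_nat n * y) = of_nat n *\<^sub>R g y" for n y
    by (induction n) (simp_all add: g.zero g.add distrib_right scaleR_add_left)
  have g_of_int: "g (of_int a * y) = of_int a *\<^sub>R g y" for a y
    by (cases a rule: int_cases2) (simp_all add: g_of_nat g.minus)
  have "g q = 0" if rat: "q \<in> \<rat>" for q
  proof -
    obtain a b where b: "b > 0" and q: "q = of_int a / of_int b"
      using Rats_cases'[OF rat] by blast
    have "of_int b *\<^sub>R g q = g (of_int a * 1)"
      using b by (simp add: q flip: g_of_int)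
    also have "\<dots> = 0"
      by (simp only: g_of_int) (simp add: g_def)
    finally show ?thesis using b by simp
  qed
  moreover have "continuous_on UNIV g"
    unfolding g_def by (intro continuous_intros cont)
  ultimately have "g x = 0"
    using continuous_constant_on_closure[of "\<rat>" g 0 x] Rats_closure_real by auto
  then show ?thesis by (simp add: g_def)
qed

lemma sol3_character:
  fixes \<phi> :: "(real \<times> real) \<times> real \<Rightarrow> real"
  assumes hom: "\<And>p q. \<phi> (sol3_mult p q) = \<phi> p + \<phi> q" and cont: "continuous_on UNIV \<phi>"
  shows "\<phi> ((x, y), u) = \<phi> ((0, 0), 1) * u"
proof -
  have split: "\<phi> ((x, y), u) = \<phi> ((x, y), 0) + \<phi> ((0, 0), u)" for x y u
    using hom[of "((x, y), 0)" "((0, 0), u)"] by simp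
  text \<open>\<open>\<phi>\<close> is constant on conjugacy classes, and conjugation by \<open>((0, 0), s)\<close> rescales the
    axes, so \<open>\<phi>\<close> takes the same value at \<open>v\<close> and at \<open>2 v\<close> for \<open>v\<close> on either axis.\<close>
  have x_axis: "\<phi> ((x, 0), 0) = 0" for x
  proof -
    have "\<phi> ((exp (- s) * x, 0), s) = \<phi> ((x, 0), s)" for s
      using hom[of "((0, 0), s)" "((x, 0), 0)"] hom[of "((x, 0), 0)" "((0, 0), s)"] by simp
    from this[of "- ln 2"] have "\<phi> ((2 * x, 0), 0) = \<phi> ((x, 0), 0)"
      using split[of "2 * x" 0 "- ln 2"] split[of x 0 "- ln 2"] by simp
    moreover have "\<phi> ((2 * x, 0), 0) = 2 * \<phi> ((x, 0), 0)"
      using hom[of "((x, 0), 0)" "((x, 0), 0)"] by simp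
    ultimately show ?thesis by simp
  qed
  have y_axis: "\<phi> ((0, y), 0) = 0" for y
  proof -
    have "\<phi> ((0, exp s * y), s) = \<phi> ((0, y), s)" for s
      using hom[of "((0, 0), s)" "((0, y), 0)"] hom[of "((0, y), 0)" "((0, 0), s)"] by simp
    from this[of "ln 2"] have "\<phi> ((0, 2 * y), 0) = \<phi> ((0, y), 0)"
      using split[of 0 "2 * y" "ln 2"] split[of 0 y "ln 2"] by simp
    moreover have "\<phi> ((0, 2 * y), 0) = 2 * \<phi> ((0, y), 0)"
      using hom[of "((0, y), 0)" "((0, y), 0)"] by simp
    ultimately show ?thesis by simp
  qed
  have "\<phi> ((x, y), 0) = 0"
    using hom[of "((x, 0), 0)" "((0, y), 0)"] by (simp add: x_axis y_axis)
  moreover have "\<phi> ((0, 0), u) = u *\<^sub>R \<phi> ((0, 0), 1)"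
  proof (rule additive_continuous_imp_scaleR)
    show "\<phi> ((0, 0), u + v) = \<phi> ((0, 0), u) + \<phi> ((0, 0), v)" for u v
      using hom[of "((0, 0), u)" "((0, 0), v)"] by simp
    show "continuous_on UNIV (\<lambda>u. \<phi> ((0, 0), u))"
      by (rule continuous_on_compose2[OF cont]) (auto intro: continuous_intros)
  qed
  ultimately show ?thesis
    using split[of x y u] by simp
qed

definition sol4_lift :: "(real \<times> real) \<times> real \<Rightarrow> real \<times> real \<times> real \<times> real" where
  "sol4_lift = (\<lambda>((x, y), u). (x, y, 0, u))"

lemma sol4_lift_apply [simp]: "sol4_lift ((x, y), u) = (x, y, 0, u)"
  by (simp add: sol4_lift_def)

lemma sol4_proj_apply [simp]: "sol4_proj (x, y, z, u) = ((x, y), u)"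
  by (simp add: sol4_proj_def)

lemma continuous_sol4_lift: "continuous_on UNIV sol4_lift"
  unfolding sol4_lift_def case_prod_unfold by (intro continuous_intros)

lemma continuous_sol4_proj: "continuous_on UNIV sol4_proj"
  unfolding sol4_proj_def case_prod_unfold by (intro continuous_intros)

lemma sol4_character:
  fixes \<psi> :: "real \<times> real \<times> real \<times> real \<Rightarrow> real"
  assumes hom: "\<And>p q. \<psi> (sol4_mult p q) = \<psi> p + \<psi> q" and cont: "continuous_on UNIV \<psi>"
  shows "\<psi> (x, y, z, u) = \<psi> (0, 0, 0, 1) * u"
proof -
  text \<open>The centre consists of commutators: \<open>(w, 1, w, 0) = (w, 0, 0, 0) (0, 1, 0, 0)\<close> equals
    \<open>(0, 1, 0, 0) (w, 0, 0, 0) (0, 0, w, 0)\<close>.\<close>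
  have centre: "\<psi> (0, 0, w, 0) = 0" for w
    using hom[of "(w, 0, 0, 0)" "(0, 1, 0, 0)"] hom[of "(0, 1, 0, 0)" "(w, 0, 0, 0)"]
      hom[of "(w, 1, 0, 0)" "(0, 0, w, 0)"] by simp
  have "\<psi> (sol4_lift (sol3_mult p q)) = \<psi> (sol4_lift p) + \<psi> (sol4_lift q)" for p q
  proof -
    obtain x y u x' y' u' where "p = ((x, y), u)" "q = ((x', y'), u')"
      by (metis prod.exhaust)
    then show ?thesis
      using hom[of "sol4_lift p" "sol4_lift q"]
        hom[of "sol4_lift (sol3_mult p q)" "(0, 0, exp u * x * y', 0)"] by (simp add: centre)
  qed
  moreover have "continuous_on UNIV (\<psi> \<circ> sol4_lift)"
    by (rule continuous_on_compose[OF continuous_sol4_lift continuous_on_subset[OF cont]]) simp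
  ultimately have "(\<psi> \<circ> sol4_lift) ((x, y), u) = (\<psi> \<circ> sol4_lift) ((0, 0), 1) * u"
    by (intro sol3_character) simp_all
  moreover have "\<psi> (x, y, z, u) = \<psi> (x, y, 0, u)"
    using hom[of "(x, y, 0, u)" "(0, 0, z, 0)"] by (simp add: centre)
  ultimately show ?thesis by simp
qed

section \<open>Automorphisms of \<open>Sol\<^sup>3\<close>\<close>

text \<open>\<open>sol3_std_aut al de a b\<close> is the diagonal map \<open>(x, y, u) \<mapsto> (al x, de y, u)\<close> followed by
  conjugation with \<open>((a, b), 0)\<close>.\<close>
definition sol3_std_aut :: "real \<Rightarrow> real \<Rightarrow> real \<Rightarrow> real \<Rightarrow> (real \<times> real) \<times> real \<Rightarrow> (real \<times> real) \<times> real" where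
  "sol3_std_aut al de a b = (\<lambda>((x, y), u). ((al * x + a * (1 - exp (- u)), de * y + b * (1 - exp u)), u))"

definition sol3_flip :: "(real \<times> real) \<times> real \<Rightarrow> (real \<times> real) \<times> real" where
  "sol3_flip = (\<lambda>((x, y), u). ((y, x), - u))"

lemma sol3_std_aut_apply [simp]:
  "sol3_std_aut al de a b ((x, y), u) = ((al * x + a * (1 - exp (- u)), de * y + b * (1 - exp u)), u)"
  by (simp add: sol3_std_aut_def)

lemma sol3_flip_apply [simp]: "sol3_flip ((x, y), u) = ((y, x), - u)"
  by (simp add: sol3_flip_def)

lemma sol3_flip_lie_auts: "sol3_flip \<in> lie_auts sol3_mult"
proof -
  have "continuous_on UNIV sol3_flip"
    unfolding sol3_flip_def case_prod_unfold by (intro continuous_intros)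
  then show ?thesis
    by (intro lie_autsI[where g = sol3_flip]) auto
qed

lemma snd_sol3_mult: "snd (sol3_mult p q) = snd p + snd q"
  by (simp add: sol3_mult_def split: prod.splits)

lemma sol3_mult_R2: "snd p = 0 \<Longrightarrow> snd q = 0 \<Longrightarrow> sol3_mult p q = (fst p + fst q, 0)"
  by (cases p; cases q) auto

lemma sol3_aut_one: "f \<in> lie_auts sol3_mult \<Longrightarrow> f ((0, 0), 0) = ((0, 0), 0)"
  using group_hom.hom_one[OF lie_auts_group_hom[OF group_Sol3, of f]] by (simp add: Sol3_def)

lemma sol3_aut_scale:
  assumes f: "f \<in> lie_auts sol3_mult"
  obtains c where "\<And>q. snd (f q) = c * snd q"
proof
  fix q :: "(real \<times> real) \<times> real"
  obtain x y u where q: "q = ((x, y), u)" by (metis prod.exhaust)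
  have "(snd \<circ> f) ((x, y), u) = (snd \<circ> f) ((0, 0), 1) * u"
  proof (rule sol3_character)
    show "(snd \<circ> f) (sol3_mult p p') = (snd \<circ> f) p + (snd \<circ> f) p'" for p p'
      by (simp add: lie_auts_hom[OF f] snd_sol3_mult)
    show "continuous_on UNIV (snd \<circ> f)"
      by (intro continuous_on_compose continuous_on_snd continuous_on_id lie_auts_continuous[OF f])
  qed
  then show "snd (f q) = snd (f ((0, 0), 1)) * snd q" by (simp add: q)
qed

lemma sol3_aut_value_form:
  assumes "\<And>q. snd (f q) = c * snd q"
  obtains A B where "f ((x, y), u) = ((A, B), c * u)"
proof -
  obtain A B where "fst (f ((x, y), u)) = (A, B)" by (cases "fst (f ((x, y), u))")
  with assms[of "((x, y), u)"] show ?thesis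
    by (intro that) (simp add: prod_eq_iff)
qed

lemma sol3_aut_linear_on_R2:
  assumes f: "f \<in> lie_auts sol3_mult" and c: "\<And>q. snd (f q) = c * snd q"
  shows "fst (f ((x, y), 0)) = x *\<^sub>R fst (f ((1, 0), 0)) + y *\<^sub>R fst (f ((0, 1), 0))"
proof -
  have add: "fst (f ((x + x', y + y'), 0)) = fst (f ((x, y), 0)) + fst (f ((x', y'), 0))" for x y x' y'
    using lie_auts_hom[OF f, of "((x, y), 0)" "((x', y'), 0)"]
    by (simp add: sol3_mult_R2 c)
  have cont: "continuous_on UNIV (\<lambda>t. fst (f (g t)))" if "continuous_on UNIV g" for g
    by (intro continuous_on_compose2[OF continuous_on_fst[OF continuous_on_id]]
        continuous_on_compose2[OF lie_auts_continuous[OF f] that]) auto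
  have "fst (f ((x, 0), 0)) = x *\<^sub>R fst (f ((1, 0), 0))"
  proof (rule additive_continuous_imp_scaleR[where f = "\<lambda>t. fst (f ((t, 0), 0))"])
    show "fst (f ((s + t, 0), 0)) = fst (f ((s, 0), 0)) + fst (f ((t, 0), 0))" for s t
      using add[where x = s and x' = t and y = 0 and y' = 0] by simp
    show "continuous_on UNIV (\<lambda>t. fst (f ((t, 0), 0)))"
      by (rule cont) (intro continuous_intros)
  qed
  moreover have "fst (f ((0, y), 0)) = y *\<^sub>R fst (f ((0, 1), 0))"
  proof (rule additive_continuous_imp_scaleR[where f = "\<lambda>t. fst (f ((0, t), 0))"])
    show "fst (f ((0, s + t), 0)) = fst (f ((0, s), 0)) + fst (f ((0, t), 0))" for s t
      using add[where x = 0 and x' = 0 and y = s and y' = t] by simp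
    show "continuous_on UNIV (\<lambda>t. fst (f ((0, t), 0)))"
      by (rule cont) (intro continuous_intros)
  qed
  ultimately show ?thesis
    using add[where x' = 0 and y = 0 and y' = y] by simp
qed

lemma sol3_aut_conj:
  assumes f: "f \<in> lie_auts sol3_mult" and c: "\<And>q. snd (f q) = c * snd q"
  shows "fst (f ((exp (- s) * x, exp s * y), 0)) =
    (exp (- (c * s)) * fst (fst (f ((x, y), 0))), exp (c * s) * snd (fst (f ((x, y), 0))))"
proof -
  obtain P Q where PQ: "f ((0, 0), s) = ((P, Q), c * s)"
    using c by (rule sol3_aut_value_form)
  obtain A B where AB: "f ((x, y), 0) = ((A, B), c * 0)"
    using c by (rule sol3_aut_value_form)
  obtain A' B' where A'B': "f ((exp (- s) * x, exp s * y), 0) = ((A', B'), c * 0)"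
    using c by (rule sol3_aut_value_form)
  have "sol3_mult ((0, 0), s) ((x, y), 0) = sol3_mult ((exp (- s) * x, exp s * y), 0) ((0, 0), s)"
    by simp
  then have "sol3_mult (f ((0, 0), s)) (f ((x, y), 0)) = sol3_mult (f ((exp (- s) * x, exp s * y), 0)) (f ((0, 0), s))"
    by (simp flip: lie_auts_hom[OF f])
  then show ?thesis
    by (simp add: PQ AB A'B')
qed

lemma sol3_aut_scale_cases:
  assumes f: "f \<in> lie_auts sol3_mult" and c: "\<And>q. snd (f q) = c * snd q"
  shows "c = 1 \<or> c = -1"
proof -
  obtain A B where AB: "f ((1, 0), 0) = ((A, B), c * 0)"
    using c by (rule sol3_aut_value_form)
  have "f ((1, 0), 0) \<noteq> f ((0, 0), 0)"
    by (simp add: lie_auts_eq_iff[OF f])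
  then have ne: "A \<noteq> 0 \<or> B \<noteq> 0"
    by (simp add: AB sol3_aut_one[OF f])
  have "(exp (- c) * A, exp c * B) = fst (f ((exp (- 1) * 1, exp 1 * 0), 0))"
    using sol3_aut_conj[OF f c, of 1 1 0] by (simp add: AB)
  also have "\<dots> = (exp (- 1) * A, exp (- 1) * B)"
    using sol3_aut_linear_on_R2[OF f c, of "exp (- 1)" 0] by (simp add: AB)
  finally show ?thesis
    using ne by auto
qed

lemma sol3_aut_translation_part:
  assumes f: "f \<in> lie_auts sol3_mult" and c: "\<And>q. snd (f q) = snd q"
  obtains a b where "\<And>s. fst (f ((0, 0), s)) = (a * (1 - exp (- s)), b * (1 - exp s))"
proof
  define P Q where "P s = fst (fst (f ((0, 0), s)))" and "Q s = snd (fst (f ((0, 0), s)))" for s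
  have fs: "f ((0, 0), s) = ((P s, Q s), s)" for s
    using c[of "((0, 0), s)"] by (simp add: P_def Q_def prod_eq_iff)
  text \<open>Compare \<open>f ((0, 0), s + 1)\<close> computed as \<open>f ((0, 0), s) f ((0, 0), 1)\<close> and as \<open>f ((0, 0), 1) f ((0, 0), s)\<close>.\<close>
  have "f ((0, 0), s + 1) = sol3_mult (f ((0, 0), s)) (f ((0, 0), 1))"
    "f ((0, 0), s + 1) = sol3_mult (f ((0, 0), 1)) (f ((0, 0), s))" for s
    by (simp_all add: add.commute flip: lie_auts_hom[OF f])
  then have "P s * (1 - exp (- 1)) = P 1 * (1 - exp (- s))" "Q s * (1 - exp 1) = Q 1 * (1 - exp s)" for s
    by (simp_all add: fs algebra_simps)
  then show "fst (f ((0, 0), s)) = (P 1 / (1 - exp (- 1)) * (1 - exp (- s)), Q 1 / (1 - exp 1) * (1 - exp s))" for s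
    by (simp add: fs field_simps)
qed

lemma sol3_aut_orientation_preserving:
  assumes f: "f \<in> lie_auts sol3_mult" and c: "\<And>q. snd (f q) = snd q"
  shows "\<exists>al de a b. al \<noteq> 0 \<and> de \<noteq> 0 \<and> f = sol3_std_aut al de a b"
proof -
  have c': "snd (f q) = 1 * snd q" for q by (simp add: c)
  obtain al be where e1: "fst (f ((1, 0), 0)) = (al, be)" by (metis prod.exhaust)
  obtain ga de where e2: "fst (f ((0, 1), 0)) = (ga, de)" by (metis prod.exhaust)
  have "(exp (- 1) * al, exp 1 * be) = fst (f ((exp (- 1) * 1, exp 1 * 0), 0))"
    using sol3_aut_conj[OF f c', of 1 1 0] by (simp add: e1)
  also have "\<dots> = (exp (- 1) * al, exp (- 1) * be)"
    using sol3_aut_linear_on_R2[OF f c', of "exp (- 1)" 0] by (simp add: e1)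
  finally have "be = 0" by simp
  have "(exp (- 1) * ga, exp 1 * de) = fst (f ((exp (- 1) * 0, exp 1 * 1), 0))"
    using sol3_aut_conj[OF f c', of 1 0 1] by (simp add: e2)
  also have "\<dots> = (exp 1 * ga, exp 1 * de)"
    using sol3_aut_linear_on_R2[OF f c', of 0 "exp 1"] by (simp add: e2)
  finally have "ga = 0" by simp
  obtain a b where ab: "\<And>s. fst (f ((0, 0), s)) = (a * (1 - exp (- s)), b * (1 - exp s))"
    using sol3_aut_translation_part[OF f c] by blast
  have "f = sol3_std_aut al de a b"
  proof
    fix q :: "(real \<times> real) \<times> real"
    obtain x y u where q: "q = ((x, y), u)" by (metis prod.exhaust)
    have "f ((x, y), 0) = ((al * x, de * y), 0)"
      using sol3_aut_linear_on_R2[OF f c', of x y] c[of "((x, y), 0)"]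
      by (simp add: e1 e2 \<open>be = 0\<close> \<open>ga = 0\<close> prod_eq_iff)
    moreover have "f ((0, 0), u) = ((a * (1 - exp (- u)), b * (1 - exp u)), u)"
      using ab[of u] c[of "((0, 0), u)"] by (simp add: prod_eq_iff)
    ultimately show "f q = sol3_std_aut al de a b q"
      using lie_auts_hom[OF f, of "((x, y), 0)" "((0, 0), u)"] by (simp add: q)
  qed
  moreover have "al \<noteq> 0" "de \<noteq> 0"
    using sol3_aut_one[OF f] lie_auts_eq_iff[OF f, of "((1, 0), 0)" "((0, 0), 0)"]
      lie_auts_eq_iff[OF f, of "((0, 1), 0)" "((0, 0), 0)"]
    by (simp_all add: calculation)
  ultimately show ?thesis by blast
qed

lemma sol3_aut_cases:
  assumes f: "f \<in> lie_auts sol3_mult"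
  shows "\<exists>al de a b. al \<noteq> 0 \<and> de \<noteq> 0 \<and>
    (f = sol3_std_aut al de a b \<or> f = sol3_std_aut al de a b \<circ> sol3_flip)"
proof -
  obtain c where c: "\<And>q. snd (f q) = c * snd q"
    using sol3_aut_scale[OF f] by blast
  consider "c = 1" | "c = -1"
    using sol3_aut_scale_cases[OF f c] by blast
  then show ?thesis
  proof cases
    case 1
    then have "\<exists>al de a b. al \<noteq> 0 \<and> de \<noteq> 0 \<and> f = sol3_std_aut al de a b"
      using sol3_aut_orientation_preserving[OF f] c by simp
    then show ?thesis by blast
  next
    case 2
    have "f \<circ> sol3_flip \<in> lie_auts sol3_mult"
      by (rule lie_auts_comp[OF f sol3_flip_lie_auts])
    moreover have "snd ((f \<circ> sol3_flip) q) = snd q" for q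
      using c[of "sol3_flip q"] 2 by (cases q) auto
    ultimately obtain al de a b where "al \<noteq> 0" "de \<noteq> 0" "f \<circ> sol3_flip = sol3_std_aut al de a b"
      using sol3_aut_orientation_preserving by blast
    moreover have "f = (f \<circ> sol3_flip) \<circ> sol3_flip"
      by (auto simp: fun_eq_iff)
    ultimately show ?thesis by auto
  qed
qed

section \<open>The induced map \<open>Aut(Sol\<^sub>1\<^sup>4) \<rightarrow> Aut(Sol\<^sup>3)\<close> and its kernel\<close>

lemma sol4_proj_mult: "sol4_proj (sol4_mult p q) = sol3_mult (sol4_proj p) (sol4_proj q)"
  by (cases p; cases q) simp

lemma sol4_proj_lift [simp]: "sol4_proj (sol4_lift q) = q"
  by (simp add: sol4_lift_def sol4_proj_def split: prod.splits)

lemma sol4_lift_proj_centre: "sol4_mult (sol4_lift (sol4_proj p)) (0, 0, fst (snd (snd p)), 0) = p"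
  by (cases p) simp

lemma sol4_central_imp_centre:
  assumes "\<And>q. sol4_mult c q = sol4_mult q c"
  shows "\<exists>w. c = (0, 0, w, 0)"
proof -
  obtain x y z u where c: "c = (x, y, z, u)" by (cases c)
  have "(1 - exp (- 1)) * x = 0" "(1 - exp 1) * y = 0"
    using assms[of "(0, 0, 0, 1)"] by (simp_all add: c algebra_simps)
  then have "x = 0" "y = 0"
    by simp_all
  moreover have "exp (- u) = 1"
    using assms[of "(1, 0, 0, 0)"] by (simp add: c \<open>x = 0\<close>)
  ultimately show ?thesis
    by (simp add: c)
qed

lemma sol4_centre_central: "sol4_mult (0, 0, w, 0) q = sol4_mult q (0, 0, w, 0)"
  by (cases q) simp

lemma sol4_aut_centre:
  assumes "f \<in> lie_auts sol4_mult"
  shows "\<exists>w'. f (0, 0, w, 0) = (0, 0, w', 0)"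
  by (intro sol4_central_imp_centre lie_auts_preserve_central[OF assms] sol4_centre_central)

definition induced_aut :: "(real \<times> real \<times> real \<times> real \<Rightarrow> real \<times> real \<times> real \<times> real) \<Rightarrow>
    (real \<times> real) \<times> real \<Rightarrow> (real \<times> real) \<times> real" where
  "induced_aut f = sol4_proj \<circ> f \<circ> sol4_lift"

text \<open>An automorphism preserves the centre, so it descends to \<open>Sol\<^sup>3\<close>.\<close>
lemma sol4_proj_aut:
  assumes f: "f \<in> lie_auts sol4_mult"
  shows "sol4_proj (f p) = induced_aut f (sol4_proj p)"
proof -
  obtain w' where w': "f (0, 0, fst (snd (snd p)), 0) = (0, 0, w', 0)"
    using sol4_aut_centre[OF f] by blast
  have "f p = f (sol4_mult (sol4_lift (sol4_proj p)) (0, 0, fst (snd (snd p)), 0))"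
    by (simp only: sol4_lift_proj_centre)
  also have "\<dots> = sol4_mult (f (sol4_lift (sol4_proj p))) (0, 0, w', 0)"
    by (simp only: lie_auts_hom[OF f] w')
  finally show ?thesis
    by (cases "f (sol4_lift (sol4_proj p))") (simp add: induced_aut_def)
qed

lemma induced_aut_comp:
  assumes "f \<in> lie_auts sol4_mult"
  shows "induced_aut (f \<circ> g) = induced_aut f \<circ> induced_aut g"
proof
  fix q
  have "induced_aut (f \<circ> g) q = sol4_proj (f (g (sol4_lift q)))"
    by (simp add: induced_aut_def)
  also have "\<dots> = induced_aut f (sol4_proj (g (sol4_lift q)))"
    by (rule sol4_proj_aut[OF assms])
  finally show "induced_aut (f \<circ> g) q = (induced_aut f \<circ> induced_aut g) q"
    by (simp add: induced_aut_def)
qed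

lemma induced_aut_id: "induced_aut id = id"
  by (simp add: fun_eq_iff induced_aut_def)

lemma induced_aut_lie_auts:
  assumes f: "f \<in> lie_auts sol4_mult"
  shows "induced_aut f \<in> lie_auts sol3_mult"
proof -
  obtain g where g: "g \<in> lie_auts sol4_mult" "g \<circ> f = id" "f \<circ> g = id"
    using f by (rule lie_auts_inverse)
  have cont: "continuous_on UNIV (induced_aut h)" if "h \<in> lie_auts sol4_mult" for h
  proof -
    have "continuous_on UNIV (sol4_proj \<circ> h)"
      by (rule continuous_on_compose[OF lie_auts_continuous[OF that]])
        (rule continuous_on_subset[OF continuous_sol4_proj], simp)
    then show ?thesis
      unfolding induced_aut_def
      by (rule continuous_on_compose[OF continuous_sol4_lift continuous_on_subset]) simp
  qed
  show ?thesis
  proof (rule lie_autsI[where g = "induced_aut g"])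
    fix p q
    have "induced_aut f (sol3_mult p q) = sol4_proj (f (sol4_mult (sol4_lift p) (sol4_lift q)))"
      using sol4_proj_aut[OF f, of "sol4_mult (sol4_lift p) (sol4_lift q)"] by (simp add: sol4_proj_mult)
    also have "\<dots> = sol3_mult (induced_aut f p) (induced_aut f q)"
      by (simp add: lie_auts_hom[OF f] sol4_proj_mult induced_aut_def)
    finally show "induced_aut f (sol3_mult p q) = sol3_mult (induced_aut f p) (induced_aut f q)" .
  next
    have "induced_aut g \<circ> induced_aut f = id" "induced_aut f \<circ> induced_aut g = id"
      using induced_aut_comp[OF g(1), of f] induced_aut_comp[OF f, of g] g(2,3)
      by (simp_all add: induced_aut_id)
    then show "induced_aut g (induced_aut f q) = q" "induced_aut f (induced_aut g q) = q" for q
      by (simp_all add: pointfree_idE)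
  qed (simp_all add: cont f g(1))
qed

lemma group_hom_induced_aut: "group_hom Aut_Sol4 Aut_Sol3 induced_aut"
  by (simp add: group_hom_def group_hom_axioms_def group_Aut_group hom_def
      induced_aut_lie_auts induced_aut_comp)

lemma aut_kernel_eq_kernel: "aut_kernel = kernel Aut_Sol4 Aut_Sol3 induced_aut"
proof -
  have iff: "(\<forall>p. sol4_proj (f p) = sol4_proj p) \<longleftrightarrow> induced_aut f = id"
    if f: "f \<in> lie_auts sol4_mult" for f
  proof
    assume "\<forall>p. sol4_proj (f p) = sol4_proj p"
    then show "induced_aut f = id" by (simp add: fun_eq_iff induced_aut_def)
  next
    assume "induced_aut f = id"
    then show "\<forall>p. sol4_proj (f p) = sol4_proj p"
      by (simp only: sol4_proj_aut[OF f] id_apply simp_thms)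
  qed
  have "aut_kernel = {f \<in> lie_auts sol4_mult. induced_aut f = id}"
    unfolding aut_kernel_def
  proof (rule Collect_cong)
    show "(f \<in> lie_auts sol4_mult \<and> (\<forall>p. sol4_proj (f p) = sol4_proj p)) \<longleftrightarrow>
        (f \<in> lie_auts sol4_mult \<and> induced_aut f = id)" for f
      using iff[of f] by blast
  qed
  then show ?thesis
    by (simp add: kernel_def)
qed

lemma aut_kernel_eq_range_khat: "aut_kernel = range khat"
proof
  show "range khat \<subseteq> aut_kernel"
    by (auto simp: aut_kernel_def khat_lie_auts)
next
  show "aut_kernel \<subseteq> range khat"
  proof
    fix f assume "f \<in> aut_kernel"
    then have f: "f \<in> lie_auts sol4_mult" and proj: "\<And>p. sol4_proj (f p) = sol4_proj p"
      by (auto simp: aut_kernel_def)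
    text \<open>\<open>f\<close> only shifts the central coordinate, by a character \<open>\<theta>\<close> of \<open>Sol\<^sub>1\<^sup>4\<close>.\<close>
    define \<theta> where "\<theta> p = fst (snd (snd (f p))) - fst (snd (snd p))" for p
    have f_eq: "f (x, y, z, u) = (x, y, z + \<theta> (x, y, z, u), u)" for x y z u
      using proj[of "(x, y, z, u)"] by (cases "f (x, y, z, u)") (simp add: \<theta>_def)
    have "\<theta> (sol4_mult p q) = \<theta> p + \<theta> q" for p q
      using lie_auts_hom[OF f, of p q] by (cases p; cases q) (simp add: f_eq)
    moreover have "continuous_on UNIV \<theta>"
    proof -
      have "continuous_on UNIV (\<lambda>p. fst (snd (snd (f p))))"
        by (rule continuous_on_compose2[where t = UNIV, OF _ lie_auts_continuous[OF f]])
          (intro continuous_intros, simp)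
      then show ?thesis
        unfolding \<theta>_def by (rule continuous_on_diff) (intro continuous_intros)
    qed
    ultimately have \<theta>_eq: "\<theta> (x, y, z, u) = \<theta> (0, 0, 0, 1) * u" for x y z u
      by (rule sol4_character)
    have "f = khat (\<theta> (0, 0, 0, 1))"
    proof
      fix p :: "real \<times> real \<times> real \<times> real"
      obtain x y z u where p: "p = (x, y, z, u)" by (cases p)
      show "f p = khat (\<theta> (0, 0, 0, 1)) p"
        by (simp add: p f_eq \<theta>_eq[of x y z u])
    qed
    then show "f \<in> range khat" by blast
  qed
qed

section \<open>The complement \<open>\<real>\<^sup>+ \<times> D\<^sub>4\<close>\<close>

definition diag_mat :: "real \<Rightarrow> real \<Rightarrow> real^2^2" where
  "diag_mat s t = vector [vector [s, 0], vector [0, t]]"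

definition anti_mat :: "real \<Rightarrow> real \<Rightarrow> real^2^2" where
  "anti_mat s t = vector [vector [0, s], vector [t, 0]]"

lemma diag_mat_nth [simp]:
  "diag_mat s t $ 1 $ 1 = s" "diag_mat s t $ 1 $ 2 = 0" "diag_mat s t $ 2 $ 1 = 0" "diag_mat s t $ 2 $ 2 = t"
  by (simp_all add: diag_mat_def)

lemma anti_mat_nth [simp]:
  "anti_mat s t $ 1 $ 1 = 0" "anti_mat s t $ 1 $ 2 = s" "anti_mat s t $ 2 $ 1 = t" "anti_mat s t $ 2 $ 2 = 0"
  by (simp_all add: anti_mat_def)

lemma mat2_eq_iff:
  "(A :: real^2^2) = B \<longleftrightarrow> A$1$1 = B$1$1 \<and> A$1$2 = B$1$2 \<and> A$2$1 = B$2$1 \<and> A$2$2 = B$2$2"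
  by (auto simp: vec_eq_iff forall_2)

lemma mat2_mult_nth: "((A :: real^2^2) ** B) $ i $ j = A$i$1 * B$1$j + A$i$2 * B$2$j"
  by (simp add: matrix_matrix_mult_def sum_2)

lemma diag_mat_mult [simp]:
  "diag_mat s t ** diag_mat s' t' = diag_mat (s * s') (t * t')"
  "diag_mat s t ** anti_mat s' t' = anti_mat (s * s') (t * t')"
  "anti_mat s t ** diag_mat s' t' = anti_mat (s * t') (t * s')"
  "anti_mat s t ** anti_mat s' t' = diag_mat (s * t') (t * s')"
  by (simp_all add: mat2_eq_iff mat2_mult_nth)

lemma mat_1_eq_diag_mat: "mat 1 = diag_mat 1 1"
  by (simp add: mat2_eq_iff mat_def)

lemma D4_simps [simp]: "A \<otimes>\<^bsub>D4\<^esub> B = A ** B" "\<one>\<^bsub>D4\<^esub> = mat 1"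
  by (simp_all add: D4_def)

lemma D4_carrier:
  "carrier D4 = {A. \<exists>s t. s \<in> {-1, 1} \<and> t \<in> {-1, 1} \<and> (A = diag_mat s t \<or> A = anti_mat s t)}"
  by (simp add: D4_def diag_mat_def anti_mat_def)

lemma D4_cases:
  assumes "A \<in> carrier D4"
  obtains s t where "s \<in> {-1, 1}" "t \<in> {-1, 1}" "A = diag_mat s t"
    | s t where "s \<in> {-1, 1}" "t \<in> {-1, 1}" "A = anti_mat s t"
  using assms unfolding D4_carrier by blast

lemma diag_mat_in_D4: "s \<in> {-1, 1} \<Longrightarrow> t \<in> {-1, 1} \<Longrightarrow> diag_mat s t \<in> carrier D4"
  and anti_mat_in_D4: "s \<in> {-1, 1} \<Longrightarrow> t \<in> {-1, 1} \<Longrightarrow> anti_mat s t \<in> carrier D4"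
  unfolding D4_carrier by blast+

lemma group_D4: "group D4"
proof (rule groupI)
  fix A B assume "A \<in> carrier D4" "B \<in> carrier D4"
  then show "A \<otimes>\<^bsub>D4\<^esub> B \<in> carrier D4"
    by (elim D4_cases) (auto intro!: diag_mat_in_D4 anti_mat_in_D4)
next
  fix A assume "A \<in> carrier D4"
  then show "\<exists>B\<in>carrier D4. B \<otimes>\<^bsub>D4\<^esub> A = \<one>\<^bsub>D4\<^esub>"
  proof (cases rule: D4_cases)
    case (1 s t)
    then show ?thesis
      by (intro bexI[of _ "diag_mat s t"] diag_mat_in_D4) (auto simp: mat_1_eq_diag_mat)
  next
    case (2 s t)
    then show ?thesis
      by (intro bexI[of _ "anti_mat t s"] anti_mat_in_D4) (auto simp: mat_1_eq_diag_mat)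
  qed
qed (auto simp: matrix_mul_assoc intro: diag_mat_in_D4[of 1 1, folded mat_1_eq_diag_mat])

text \<open>\<open>scale_sign_aut r A\<close> acts on the \<open>(x, y)\<close>-coordinates by the matrix \<open>r A\<close>.\<close>
definition scale_sign_aut :: "real \<Rightarrow> real^2^2 \<Rightarrow> real \<times> real \<times> real \<times> real \<Rightarrow> real \<times> real \<times> real \<times> real" where
  "scale_sign_aut r A =
    (if A $ 1 $ 2 = 0 then diag_aut (r * A $ 1 $ 1) (r * A $ 2 $ 2)
     else diag_aut (r * A $ 1 $ 2) (r * A $ 2 $ 1) \<circ> flip_aut)"

lemma scale_sign_aut_diag_mat [simp]: "scale_sign_aut r (diag_mat s t) = diag_aut (r * s) (r * t)"
  by (simp add: scale_sign_aut_def)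

lemma scale_sign_aut_anti_mat [simp]:
  "s \<noteq> 0 \<Longrightarrow> scale_sign_aut r (anti_mat s t) = diag_aut (r * s) (r * t) \<circ> flip_aut"
  by (simp add: scale_sign_aut_def)

definition scale_sign_auts :: "(real \<times> real \<times> real \<times> real \<Rightarrow> real \<times> real \<times> real \<times> real) set" where
  "scale_sign_auts = (\<lambda>(r, A). scale_sign_aut r A) ` carrier (R_pos \<times>\<times> D4)"

lemma scale_sign_aut_mult:
  assumes "A \<in> carrier D4" "B \<in> carrier D4"
  shows "scale_sign_aut (r * r') (A ** B) = scale_sign_aut r A \<circ> scale_sign_aut r' B"
proof -
  have nz: "s \<noteq> 0" if "s \<in> {-1, 1::real}" for s
    using that by auto
  have flip_flip: "f \<circ> flip_aut \<circ> flip_aut = f" for f :: "real \<times> real \<times> real \<times> real \<Rightarrow> real \<times> real \<times> real \<times> real"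
    by (simp add: comp_assoc flip_aut_comp_flip_aut)
  note simps = diag_aut_comp_diag_aut flip_aut_comp_diag_aut flip_aut_comp_flip_aut flip_flip algebra_simps
  from assms(1) show ?thesis
  proof (cases rule: D4_cases)
    case A: (1 s t)
    from assms(2) show ?thesis
      by (cases rule: D4_cases) (use A nz in \<open>simp_all add: simps flip: comp_assoc\<close>)
  next
    case A: (2 s t)
    from assms(2) show ?thesis
      by (cases rule: D4_cases) (use A nz in \<open>simp_all add: simps comp_assoc, simp_all add: simps flip: comp_assoc\<close>)
  qed
qed

lemma scale_sign_aut_hom:
  "(\<lambda>(r, A). scale_sign_aut r A) \<in> hom (R_pos \<times>\<times> D4) Aut_Sol4"
proof (rule homI)
  fix p assume "p \<in> carrier (R_pos \<times>\<times> D4)"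
  then obtain r A where "p = (r, A)" "r > 0" "A \<in> carrier D4"
    by (auto simp: R_pos_def)
  then show "(\<lambda>(r, A). scale_sign_aut r A) p \<in> carrier Aut_Sol4"
    by (auto elim!: D4_cases intro!: lie_auts_comp diag_aut_lie_auts flip_aut_lie_auts)
next
  fix p q assume "p \<in> carrier (R_pos \<times>\<times> D4)" "q \<in> carrier (R_pos \<times>\<times> D4)"
  then obtain r A r' B where "p = (r, A)" "q = (r', B)" "A \<in> carrier D4" "B \<in> carrier D4"
    by auto
  then show "(\<lambda>(r, A). scale_sign_aut r A) (p \<otimes>\<^bsub>R_pos \<times>\<times> D4\<^esub> q) =
      (\<lambda>(r, A). scale_sign_aut r A) p \<otimes>\<^bsub>Aut_Sol4\<^esub> (\<lambda>(r, A). scale_sign_aut r A) q"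
    by (simp add: R_pos_def scale_sign_aut_mult)
qed

section \<open>The two semidirect decompositions\<close>

lemma group_R_add: "group R_add"
proof (rule groupI)
  fix x assume "x \<in> carrier R_add"
  then show "\<exists>y\<in>carrier R_add. y \<otimes>\<^bsub>R_add\<^esub> x = \<one>\<^bsub>R_add\<^esub>"
    by (intro bexI[of _ "- x"]) (simp_all add: R_add_def)
qed (simp_all add: R_add_def)

lemma group_R_pos: "group R_pos"
proof (rule groupI)
  fix x assume "x \<in> carrier R_pos"
  then show "\<exists>y\<in>carrier R_pos. y \<otimes>\<^bsub>R_pos\<^esub> x = \<one>\<^bsub>R_pos\<^esub>"
    by (intro bexI[of _ "1 / x"]) (simp_all add: R_pos_def)
qed (simp_all add: R_pos_def)

definition inner_auts :: "(real \<times> real \<times> real \<times> real \<Rightarrow> real \<times> real \<times> real \<times> real) set" where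
  "inner_auts = range (inner_aut Sol4)"

lemma inner_auts_normal: "inner_auts \<lhd> Aut_Sol4"
proof -
  interpret Aut: group Aut_Sol4 by (rule group_Aut_group)
  have "subgroup inner_auts Aut_Sol4"
    using group_hom.img_is_subgroup[of Sol4 Aut_Sol4 "inner_aut Sol4"] inner_aut_Sol4_hom
    by (simp add: group_hom_def group_hom_axioms_def group_Sol4 group_Aut_group inner_auts_def)
  moreover have "x \<otimes>\<^bsub>Aut_Sol4\<^esub> h \<otimes>\<^bsub>Aut_Sol4\<^esub> inv\<^bsub>Aut_Sol4\<^esub> x \<in> inner_auts"
    if x: "x \<in> carrier Aut_Sol4" and h: "h \<in> inner_auts" for x h
  proof -
    obtain g where g: "h = inner_aut Sol4 g" using h by (auto simp: inner_auts_def)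
    have "x \<otimes>\<^bsub>Aut_Sol4\<^esub> h \<otimes>\<^bsub>Aut_Sol4\<^esub> inv\<^bsub>Aut_Sol4\<^esub> x =
        inner_aut Sol4 (x g) \<circ> (x \<otimes>\<^bsub>Aut_Sol4\<^esub> inv\<^bsub>Aut_Sol4\<^esub> x)"
      using x by (simp add: g sol4_aut_comp_inner_aut comp_assoc)
    also have "\<dots> = inner_aut Sol4 (x g)"
      using Aut.r_inv[OF x] by simp
    finally show ?thesis by (simp add: inner_auts_def)
  qed
  ultimately show ?thesis
    by (simp add: Aut.normal_inv_iff)
qed

lemma aut_kernel_normal: "aut_kernel \<lhd> Aut_Sol4"
  by (simp add: aut_kernel_eq_kernel group_hom.normal_kernel[OF group_hom_induced_aut])

lemma group_hom_scale_sign_aut: "group_hom (R_pos \<times>\<times> D4) Aut_Sol4 (\<lambda>(r, A). scale_sign_aut r A)"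
  by (simp add: group_hom_def group_hom_axioms_def DirProd_group group_R_pos group_D4
      group_Aut_group scale_sign_aut_hom)

lemma scale_sign_auts_subgroup: "subgroup scale_sign_auts Aut_Sol4"
  unfolding scale_sign_auts_def by (rule group_hom.img_is_subgroup[OF group_hom_scale_sign_aut])

lemma diag_aut_factor:
  assumes "al \<noteq> 0" "de \<noteq> 0"
  obtains v r s t where "r > 0" "s \<in> {-1, 1}" "t \<in> {-1, 1}"
    "diag_aut al de = inner_aut Sol4 (0, 0, 0, v) \<circ> scale_sign_aut r (diag_mat s t)"
proof
  define r where "r = sqrt (\<bar>al\<bar> * \<bar>de\<bar>)"
  define v where "v = ln (r / \<bar>al\<bar>)"
  show r: "r > 0" using assms by (simp add: r_def)
  show "sgn al \<in> {-1, 1}" "sgn de \<in> {-1, 1}" using assms by (auto simp: sgn_if)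
  have ev: "exp v = r / \<bar>al\<bar>" and emv: "exp (- v) = \<bar>al\<bar> / r"
    using r assms by (simp_all add: v_def exp_minus)
  have rr: "r * r = \<bar>al\<bar> * \<bar>de\<bar>" by (simp add: r_def)
  have x_coeff: "exp (- v) * (r * sgn al) = al"
    using r by (simp add: emv abs_mult_sgn)
  have "exp v * (r * sgn de) = (r * r) / \<bar>al\<bar> * sgn de"
    by (simp add: ev)
  also have "\<dots> = de"
    using assms by (simp add: rr abs_mult_sgn)
  finally have y_coeff: "exp v * (r * sgn de) = de" .
  have z_coeff: "r * sgn al * (r * sgn de) = al * de"
    using rr by (metis abs_mult_sgn mult.assoc mult.left_commute)
  show "diag_aut al de = inner_aut Sol4 (0, 0, 0, v) \<circ> scale_sign_aut r (diag_mat (sgn al) (sgn de))"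
    using x_coeff y_coeff z_coeff
    by (simp add: fun_eq_iff inner_aut_Sol4 mult.assoc)
qed

lemma induced_aut_inner_aut_diag_aut:
  "induced_aut (inner_aut Sol4 (a, b, 0, 0) \<circ> diag_aut al de) = sol3_std_aut al de a b"
  "induced_aut (inner_aut Sol4 (a, b, 0, 0) \<circ> diag_aut al de \<circ> flip_aut) = sol3_std_aut al de a b \<circ> sol3_flip"
  by (simp_all add: fun_eq_iff induced_aut_def inner_aut_Sol4)

lemma inner_aut_comp_diag_aut_mem:
  assumes "al \<noteq> 0" "de \<noteq> 0"
  shows "inner_aut Sol4 g \<circ> diag_aut al de \<in> inner_auts <#>\<^bsub>Aut_Sol4\<^esub> scale_sign_auts"
    and "inner_aut Sol4 g \<circ> diag_aut al de \<circ> flip_aut \<in> inner_auts <#>\<^bsub>Aut_Sol4\<^esub> scale_sign_auts"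
proof -
  obtain v r s t where rst: "r > 0" "s \<in> {-1, 1}" "t \<in> {-1, 1}"
    and diag: "diag_aut al de = inner_aut Sol4 (0, 0, 0, v) \<circ> scale_sign_aut r (diag_mat s t)"
    using diag_aut_factor[OF assms] .
  have mem: "scale_sign_aut r A \<in> scale_sign_auts" if "A \<in> carrier D4" for A
    unfolding scale_sign_auts_def
    by (rule image_eqI[where x = "(r, A)"]) (simp_all add: R_pos_def rst(1) that)
  have scale: "scale_sign_aut r (diag_mat s t) \<in> scale_sign_auts" "scale_sign_aut r (anti_mat s t) \<in> scale_sign_auts"
    using mem[OF diag_mat_in_D4[OF rst(2,3)]] mem[OF anti_mat_in_D4[OF rst(2,3)]] .
  have "s \<noteq> 0" using rst(2) by auto
  have diag': "inner_aut Sol4 g \<circ> diag_aut al de = inner_aut Sol4 (sol4_mult g (0, 0, 0, v)) \<circ> scale_sign_aut r (diag_mat s t)"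
    by (simp add: diag inner_aut_Sol4_mult comp_assoc)
  then have "inner_aut Sol4 g \<circ> diag_aut al de \<circ> flip_aut = inner_aut Sol4 (sol4_mult g (0, 0, 0, v)) \<circ> scale_sign_aut r (anti_mat s t)"
    using \<open>s \<noteq> 0\<close> by (simp add: comp_assoc)
  with diag' show "inner_aut Sol4 g \<circ> diag_aut al de \<in> inner_auts <#>\<^bsub>Aut_Sol4\<^esub> scale_sign_auts"
    "inner_aut Sol4 g \<circ> diag_aut al de \<circ> flip_aut \<in> inner_auts <#>\<^bsub>Aut_Sol4\<^esub> scale_sign_auts"
    unfolding set_mult_Aut_group_iff inner_auts_def using scale by blast+
qed

lemma induced_aut_image: "induced_aut ` (inner_auts <#>\<^bsub>Aut_Sol4\<^esub> scale_sign_auts) = carrier Aut_Sol3"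
proof
  have "inner_auts <#>\<^bsub>Aut_Sol4\<^esub> scale_sign_auts \<subseteq> carrier Aut_Sol4"
    using group.setmult_subset_G[OF group_Aut_group] inner_auts_normal scale_sign_auts_subgroup
    by (metis normal_imp_subgroup subgroup.subset)
  then show "induced_aut ` (inner_auts <#>\<^bsub>Aut_Sol4\<^esub> scale_sign_auts) \<subseteq> carrier Aut_Sol3"
    by (auto intro: induced_aut_lie_auts)
next
  show "carrier Aut_Sol3 \<subseteq> induced_aut ` (inner_auts <#>\<^bsub>Aut_Sol4\<^esub> scale_sign_auts)"
  proof
    fix h assume "h \<in> carrier Aut_Sol3"
    then have "h \<in> lie_auts sol3_mult" by simp
    then obtain al de a b where "al \<noteq> 0" "de \<noteq> 0"
      and h: "h = sol3_std_aut al de a b \<or> h = sol3_std_aut al de a b \<circ> sol3_flip"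
      using sol3_aut_cases by blast
    from h show "h \<in> induced_aut ` (inner_auts <#>\<^bsub>Aut_Sol4\<^esub> scale_sign_auts)"
    proof
      assume "h = sol3_std_aut al de a b"
      then show ?thesis
        by (intro image_eqI[OF _ inner_aut_comp_diag_aut_mem(1)[OF \<open>al \<noteq> 0\<close> \<open>de \<noteq> 0\<close>, of "(a, b, 0, 0)"]])
          (simp add: induced_aut_inner_aut_diag_aut)
    next
      assume "h = sol3_std_aut al de a b \<circ> sol3_flip"
      then show ?thesis
        by (intro image_eqI[OF _ inner_aut_comp_diag_aut_mem(2)[OF \<open>al \<noteq> 0\<close> \<open>de \<noteq> 0\<close>, of "(a, b, 0, 0)"]])
          (simp add: induced_aut_inner_aut_diag_aut)
    qed
  qed
qed

lemma aut_kernel_inter_inner_scale_sign_auts: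
  "aut_kernel \<inter> (inner_auts <#>\<^bsub>Aut_Sol4\<^esub> scale_sign_auts) = {id}"
proof
  show "{id} \<subseteq> aut_kernel \<inter> (inner_auts <#>\<^bsub>Aut_Sol4\<^esub> scale_sign_auts)"
    using inner_aut_comp_diag_aut_mem(1)[of 1 1 "(0, 0, 0, 0)"] rangeI[of khat 0]
    by (simp add: aut_kernel_eq_range_khat diag_aut_1 inner_aut_Sol4_one khat_0)
next
  show "aut_kernel \<inter> (inner_auts <#>\<^bsub>Aut_Sol4\<^esub> scale_sign_auts) \<subseteq> {id}"
  proof
    fix f assume f: "f \<in> aut_kernel \<inter> (inner_auts <#>\<^bsub>Aut_Sol4\<^esub> scale_sign_auts)"
    then obtain k where k: "f = khat k"
      by (auto simp: aut_kernel_eq_range_khat)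
    from f have "f \<in> inner_auts <#>\<^bsub>Aut_Sol4\<^esub> scale_sign_auts" by blast
    then obtain i h where "i \<in> inner_auts" "h \<in> scale_sign_auts" "f = i \<circ> h"
      unfolding set_mult_Aut_group_iff by blast
    then obtain p q w v r A where A: "A \<in> carrier D4"
      and f': "f = inner_aut Sol4 (p, q, w, v) \<circ> scale_sign_aut r A"
      unfolding inner_auts_def scale_sign_auts_def by (auto simp: prod_eq_iff)
    have e: "khat k (0, 0, 0, 1) = inner_aut Sol4 (p, q, w, v) (scale_sign_aut r A (0, 0, 0, 1))"
      using k f' by (metis comp_apply)
    from A have "k = 0"
    proof (cases rule: D4_cases)
      case (1 s t)
      with e show ?thesis by (simp add: inner_aut_Sol4)
    next
      case (2 s t)
      then have "s \<noteq> 0" by auto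
      with 2 e show ?thesis by (simp add: inner_aut_Sol4)
    qed
    then show "f \<in> {id}" by (simp add: k khat_0)
  qed
qed

lemma kernel_inner_auts_normal: "aut_kernel <#>\<^bsub>Aut_Sol4\<^esub> inner_auts \<lhd> Aut_Sol4"
  by (rule group.normal_set_mult_normal[OF group_Aut_group aut_kernel_normal inner_auts_normal])

lemma exp_eq_scale_sign_imp_one:
  fixes r s t v :: real
  assumes r: "r > 0" and st: "s \<in> {-1, 1}" "t \<in> {-1, 1}"
    and es: "exp (- v) = r * s" and et: "exp v = r * t"
  shows "r = 1 \<and> s = 1 \<and> t = 1"
proof -
  have "r * s > 0" "r * t > 0" "(r * s) * (r * t) = 1"
    unfolding es[symmetric] et[symmetric] by (simp_all add: exp_minus)
  with r st have "s = 1" "t = 1" "r * r = 1"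
    by (auto simp: zero_less_mult_iff)
  moreover from \<open>r * r = 1\<close> have "(r - 1) * (r + 1) = 0"
    by (simp add: algebra_simps)
  with r have "r = 1" by simp
  ultimately show ?thesis by simp
qed

lemma kernel_inner_auts_inter_scale_sign_auts:
  "(aut_kernel <#>\<^bsub>Aut_Sol4\<^esub> inner_auts) \<inter> scale_sign_auts = {id}"
proof
  have "subgroup (aut_kernel <#>\<^bsub>Aut_Sol4\<^esub> inner_auts) Aut_Sol4"
    by (rule normal_imp_subgroup[OF kernel_inner_auts_normal])
  then show "{id} \<subseteq> (aut_kernel <#>\<^bsub>Aut_Sol4\<^esub> inner_auts) \<inter> scale_sign_auts"
    using subgroup.one_closed[OF scale_sign_auts_subgroup] subgroup.one_closed by fastforce
next
  show "(aut_kernel <#>\<^bsub>Aut_Sol4\<^esub> inner_auts) \<inter> scale_sign_auts \<subseteq> {id}"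
  proof
    fix f assume f: "f \<in> (aut_kernel <#>\<^bsub>Aut_Sol4\<^esub> inner_auts) \<inter> scale_sign_auts"
    then have "f \<in> aut_kernel <#>\<^bsub>Aut_Sol4\<^esub> inner_auts" by blast
    then obtain k g where "f = khat k \<circ> inner_aut Sol4 g"
      unfolding set_mult_Aut_group_iff aut_kernel_eq_range_khat inner_auts_def by blast
    moreover obtain p q w v where "g = (p, q, w, v)" by (cases g)
    moreover from f obtain r A where "r > 0" "A \<in> carrier D4" "f = scale_sign_aut r A"
      by (auto simp: scale_sign_auts_def R_pos_def)
    ultimately have e: "khat k (inner_aut Sol4 (p, q, w, v) x) = scale_sign_aut r A x" for x
      by (metis comp_apply)
    from \<open>A \<in> carrier D4\<close> show "f \<in> {id}"
    proof (cases rule: D4_cases)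
      case (1 s t)
      have "p = 0" "q = 0" "k = 0"
        using e[of "(0, 0, 0, 1)"] 1 by (auto simp: inner_aut_Sol4)
      then have es: "exp (- v) = r * s" and et: "exp v = r * t"
        using e[of "(1, 0, 0, 0)"] e[of "(0, 1, 0, 0)"] 1 by (simp_all add: inner_aut_Sol4)
      then have "r = 1" "s = 1" "t = 1"
        using exp_eq_scale_sign_imp_one[OF \<open>r > 0\<close> 1(1,2) es et] by simp_all
      then have "f = diag_aut 1 1"
        using 1 \<open>f = scale_sign_aut r A\<close> by simp
      then show ?thesis
        by (simp add: diag_aut_1)
    next
      case (2 s t)
      then have "s \<noteq> 0" by auto
      with 2 show ?thesis
        using e[of "(0, 0, 0, 1)"] by (simp add: inner_aut_Sol4)
    qed
  qed
qed

lemma aut_kernel_iso: "Aut_Sol4\<lparr>carrier := aut_kernel\<rparr> \<cong> R_add"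
proof -
  have "khat \<in> hom R_add Aut_Sol4"
    by (rule homI) (simp_all add: R_add_def khat_lie_auts khat_comp_khat)
  moreover have "inj_on khat (carrier R_add)"
    by (rule inj_onI) (metis khat_apply add_0 mult_1_right prod.inject)
  ultimately have "Aut_Sol4\<lparr>carrier := khat ` carrier R_add\<rparr> \<cong> R_add"
    by (rule iso_image_of_inj_hom[OF group_R_add])
  then show ?thesis
    by (simp add: R_add_def aut_kernel_eq_range_khat)
qed

lemma inner_aut_Sol4_lift_mult:
  "inner_aut Sol4 (sol4_lift (sol3_mult q q')) = inner_aut Sol4 (sol4_lift q) \<circ> inner_aut Sol4 (sol4_lift q')"
proof -
  obtain x y u x' y' u' where "q = ((x, y), u)" "q' = ((x', y'), u')"
    by (metis prod.exhaust)
  then show ?thesis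
    by (simp add: flip: inner_aut_Sol4_mult)
      (rule inner_aut_Sol4_centre_invariant)
qed

definition khat_inner_aut :: "real \<times> (real \<times> real) \<times> real \<Rightarrow> real \<times> real \<times> real \<times> real \<Rightarrow> real \<times> real \<times> real \<times> real" where
  "khat_inner_aut = (\<lambda>(k, q). khat k \<circ> inner_aut Sol4 (sol4_lift q))"

lemma khat_inner_aut_hom: "khat_inner_aut \<in> hom (R_add \<times>\<times> Sol3) Aut_Sol4"
proof (rule homI)
  show "khat_inner_aut x \<in> carrier Aut_Sol4" for x
    by (cases x) (simp add: khat_inner_aut_def lie_auts_comp khat_lie_auts inner_aut_Sol4_lie_auts)
  have comm: "inner_aut Sol4 g \<circ> (khat k \<circ> h) = khat k \<circ> (inner_aut Sol4 g \<circ> h)" for g k h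
    by (simp add: khat_comp_inner_aut flip: comp_assoc)
  fix x y :: "real \<times> (real \<times> real) \<times> real"
  obtain k q k' q' where "x = (k, q)" "y = (k', q')" by (metis prod.exhaust)
  then show "khat_inner_aut (x \<otimes>\<^bsub>R_add \<times>\<times> Sol3\<^esub> y) = khat_inner_aut x \<otimes>\<^bsub>Aut_Sol4\<^esub> khat_inner_aut y"
    by (simp add: khat_inner_aut_def R_add_def Sol3_mult inner_aut_Sol4_lift_mult comp_assoc comm
        flip: khat_comp_khat)
qed

lemma inj_khat_inner_aut: "inj khat_inner_aut"
proof (rule injI)
  fix x y assume "khat_inner_aut x = khat_inner_aut y"
  moreover obtain k p q v where x: "x = (k, (p, q), v)" by (metis prod.exhaust)
  moreover obtain k' p' q' v' where y: "y = (k', (p', q'), v')" by (metis prod.exhaust)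
  ultimately have e: "khat_inner_aut (k, (p, q), v) z = khat_inner_aut (k', (p', q'), v') z" for z
    by simp
  have "p = p'" "q = q'"
    using e[of "(0, 0, 0, 1)"] by (simp_all add: khat_inner_aut_def inner_aut_Sol4)
  moreover have "k = k'" "exp (- v) = exp (- v')"
    using e[of "(0, 0, 0, 1)"] e[of "(1, 0, 0, 0)"] calculation
    by (simp_all add: khat_inner_aut_def inner_aut_Sol4)
  ultimately show "x = y" by (simp add: x y)
qed

lemma range_khat_inner_aut: "range khat_inner_aut = aut_kernel <#>\<^bsub>Aut_Sol4\<^esub> inner_auts"
proof
  show "range khat_inner_aut \<subseteq> aut_kernel <#>\<^bsub>Aut_Sol4\<^esub> inner_auts"
  proof
    fix f assume "f \<in> range khat_inner_aut"
    then obtain k q where "f = khat k \<circ> inner_aut Sol4 (sol4_lift q)"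
      by (auto simp: khat_inner_aut_def)
    then show "f \<in> aut_kernel <#>\<^bsub>Aut_Sol4\<^esub> inner_auts"
      unfolding set_mult_Aut_group_iff aut_kernel_eq_range_khat inner_auts_def by blast
  qed
  show "aut_kernel <#>\<^bsub>Aut_Sol4\<^esub> inner_auts \<subseteq> range khat_inner_aut"
  proof
    fix f assume "f \<in> aut_kernel <#>\<^bsub>Aut_Sol4\<^esub> inner_auts"
    then obtain k g where f: "f = khat k \<circ> inner_aut Sol4 g"
      unfolding set_mult_Aut_group_iff aut_kernel_eq_range_khat inner_auts_def by blast
    obtain p q w v where g: "g = (p, q, w, v)" by (cases g)
    have "f = khat_inner_aut (k, (p, q), v)"
      by (simp add: f g khat_inner_aut_def inner_aut_Sol4_centre_invariant[of p q w v 0])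
    then show "f \<in> range khat_inner_aut" by blast
  qed
qed

lemma kernel_inner_auts_iso:
  "Aut_Sol4\<lparr>carrier := aut_kernel <#>\<^bsub>Aut_Sol4\<^esub> inner_auts\<rparr> \<cong> R_add \<times>\<times> Sol3"
  using iso_image_of_inj_hom[OF DirProd_group[OF group_R_add group_Sol3] khat_inner_aut_hom]
    inj_khat_inner_aut range_khat_inner_aut
  by (simp add: R_add_def Sol3_def inj_on_subset)

lemma pos_mult_sign_cancel:
  fixes r r' s s' :: real
  assumes "r > 0" "r' > 0" "s \<in> {-1, 1}" "s' \<in> {-1, 1}" "r * s = r' * s'"
  shows "r = r' \<and> s = s'"
  using assms by auto

lemma inj_on_scale_sign_aut: "inj_on (\<lambda>(r, A). scale_sign_aut r A) (carrier (R_pos \<times>\<times> D4))"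
proof (rule inj_onI, clarsimp simp: R_pos_def)
  fix r A r' B
  assume r: "r > 0" "r' > 0" and AB: "A \<in> carrier D4" "B \<in> carrier D4"
    and eq: "scale_sign_aut r A = scale_sign_aut r' B"
  have e: "scale_sign_aut r A x = scale_sign_aut r' B x" for x
    using eq by simp
  from AB(1) show "r = r' \<and> A = B"
  proof (cases rule: D4_cases)
    case A: (1 s t)
    from AB(2) show ?thesis
    proof (cases rule: D4_cases)
      case (1 s' t')
      then have "r * s = r' * s'" "r * t = r' * t'"
        using e[of "(1, 0, 0, 0)"] e[of "(0, 1, 0, 0)"] A by simp_all
      then show ?thesis
        using pos_mult_sign_cancel[OF r A(1) 1(1)] pos_mult_sign_cancel[OF r A(2) 1(2)] A 1 by simp
    next
      case (2 s' t')
      then have "s' \<noteq> 0" by auto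
      then show ?thesis
        using e[of "(0, 0, 0, 1)"] A 2 by simp
    qed
  next
    case A: (2 s t)
    then have "s \<noteq> 0" by auto
    from AB(2) show ?thesis
    proof (cases rule: D4_cases)
      case (1 s' t')
      then show ?thesis
        using e[of "(0, 0, 0, 1)"] A \<open>s \<noteq> 0\<close> by simp
    next
      case (2 s' t')
      then have "s' \<noteq> 0" by auto
      then have "r * s = r' * s'" "r * t = r' * t'"
        using e[of "(1, 0, 0, 0)"] e[of "(0, 1, 0, 0)"] A 2 \<open>s \<noteq> 0\<close> by simp_all
      then show ?thesis
        using pos_mult_sign_cancel[OF r A(1) 2(1)] pos_mult_sign_cancel[OF r A(2) 2(2)] A 2 by simp
    qed
  qed
qed

lemma scale_sign_auts_iso: "Aut_Sol4\<lparr>carrier := scale_sign_auts\<rparr> \<cong> R_pos \<times>\<times> D4"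
  unfolding scale_sign_auts_def
  by (rule iso_image_of_inj_hom[OF DirProd_group[OF group_R_pos group_D4] scale_sign_aut_hom
        inj_on_scale_sign_aut])

lemma inner_scale_sign_auts_subgroup: "subgroup (inner_auts <#>\<^bsub>Aut_Sol4\<^esub> scale_sign_auts) Aut_Sol4"
  using second_isomorphism_grp.normal_set_mult_subgroup[of inner_auts Aut_Sol4 scale_sign_auts]
  by (simp add: second_isomorphism_grp_def second_isomorphism_grp_axioms_def inner_auts_normal
      scale_sign_auts_subgroup)

lemma kernel_inner_auts_mult_scale_sign_auts:
  "(aut_kernel <#>\<^bsub>Aut_Sol4\<^esub> inner_auts) <#>\<^bsub>Aut_Sol4\<^esub> scale_sign_auts =
    aut_kernel <#>\<^bsub>Aut_Sol4\<^esub> (inner_auts <#>\<^bsub>Aut_Sol4\<^esub> scale_sign_auts)"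
  by (rule group.set_mult_assoc[OF group_Aut_group]
      subgroup.subset[OF normal_imp_subgroup[OF aut_kernel_normal]]
      subgroup.subset[OF normal_imp_subgroup[OF inner_auts_normal]]
      subgroup.subset[OF scale_sign_auts_subgroup])+

lemma aut_kernel_subset_kernel_inner_auts: "aut_kernel \<subseteq> aut_kernel <#>\<^bsub>Aut_Sol4\<^esub> inner_auts"
proof
  fix f assume "f \<in> aut_kernel"
  moreover have "id \<in> inner_auts"
    using subgroup.one_closed[OF normal_imp_subgroup[OF inner_auts_normal]] by simp
  ultimately show "f \<in> aut_kernel <#>\<^bsub>Aut_Sol4\<^esub> inner_auts"
    unfolding set_mult_Aut_group_iff by (intro bexI[of _ f] bexI[of _ id]) simp_all
qed

theorem proposition1p3:
  shows "group Aut_Sol4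
    \<and> (\<exists>L. int_semidirect Aut_Sol4 aut_kernel L
           \<and> Aut_Sol4\<lparr>carrier := aut_kernel\<rparr> \<cong> R_add
           \<and> Aut_Sol4\<lparr>carrier := L\<rparr> \<cong> Aut_Sol3)
    \<and> (\<exists>N H. int_semidirect Aut_Sol4 N H \<and> aut_kernel \<subseteq> N
           \<and> Aut_Sol4\<lparr>carrier := N\<rparr> \<cong> R_add \<times>\<times> Sol3
           \<and> Aut_Sol4\<lparr>carrier := H\<rparr> \<cong> R_pos \<times>\<times> D4)"
proof -
  let ?L = "inner_auts <#>\<^bsub>Aut_Sol4\<^esub> scale_sign_auts"
  let ?N = "aut_kernel <#>\<^bsub>Aut_Sol4\<^esub> inner_auts"
  have KL: "int_semidirect Aut_Sol4 aut_kernel ?L \<and> Aut_Sol4\<lparr>carrier := ?L\<rparr> \<cong> Aut_Sol3"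
    using int_semidirect_kernel_complement[OF group_hom_induced_aut inner_scale_sign_auts_subgroup
        induced_aut_image] aut_kernel_inter_inner_scale_sign_auts
    by (simp add: aut_kernel_eq_kernel)
  then have "int_semidirect Aut_Sol4 ?N scale_sign_auts"
    using kernel_inner_auts_normal scale_sign_auts_subgroup kernel_inner_auts_inter_scale_sign_auts
    by (simp add: int_semidirect_def kernel_inner_auts_mult_scale_sign_auts)
  then show ?thesis
    using group_Aut_group KL aut_kernel_subset_kernel_inner_auts aut_kernel_iso
      kernel_inner_auts_iso scale_sign_auts_iso by blast
qed

end
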